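(* Fix $\tau$ in the upper half-plane and let $F(z|\tau)$ and $G(z|\tau)$ be entire functions of $z$ satisfying \[ F(z|\tau)=F(z+\pi|\tau)=q^{3} e^{12iz}F(z+\pi\tau|\tau),\qquad G(z|\tau)=G(z+\pi|\tau)=q^{3} e^{12iz}G(z+\pi\tau|\tau) \] for all $z$. Then there exists a constant $C$ independent of $x$ and $y$ such that for all complex $x,y$, \begin{align*} &\big(F(x|\tau)-F(-x|\tau)\big)\big(G(y|\tau)-G(-y|\tau)\big)-\big(F(y|\tau)-F(-y|\tau)\big)\big(G(x|\tau)-G(-x|\tau)\big)\\ &=C\,\theta_1(x-y|\tau)\theta_1(x+y|\tau)\theta_1(2x|\tau)\theta_1(2y|\tau). \end{align*}
   Context: $q=e^{2\pi i\tau}$ with $\operatorname{Im}\tau>0$; $q^a=e^{2\pi i a\tau}$ for real $a$. The Jacobi theta function is $\theta_1(z|\tau)=2\sum_{n\ge 0}(-1)^n q^{(2n+1)^2/8}\sin((2n+1)z)$. *)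

theory Defs
  imports "HOL-Complex_Analysis.Complex_Analysis"
begin

text \<open>
  \<open>qpow \<tau> a\<close> is $q^a = e^{2\pi i a\tau}$ for real $a$, with $q = e^{2\pi i\tau}$. It is defined through
  \<open>\<tau>\<close> and not through the complex power \<open>powr\<close>, whose principal branch can give a different value
  for non-integral \<open>a\<close>.
\<close>

definition qpow :: "complex \<Rightarrow> real \<Rightarrow> complex" where
  "qpow \<tau> a = exp (2 * of_real pi * \<i> * of_real a * \<tau>)"

text \<open>The quasi-periods in \<open>z\<close> are \<open>\<pi>\<close> and \<open>\<pi>\<tau>\<close>. The series converges for \<open>Im \<tau> > 0\<close>.\<close>

definition theta1 :: "complex \<Rightarrow> complex \<Rightarrow> complex" where
  "theta1 z \<tau> =
     2 * (\<Sum>n. (- 1) ^ n * qpow \<tau> ((2 * real n + 1)\<^sup>2 / 8) * sin ((2 * of_nat n + 1) * z))"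

end

theory Submission
  imports Defs
begin

text \<open>
  The odd parts of \<open>F\<close> and \<open>G\<close> are odd theta functions of degree six: entire functions of period
  \<open>\<pi>\<close> with \<open>f (z + \<pi>\<tau>) = q\<^bsup>-3\<^esup> e\<^bsup>-12iz\<^esup> f z\<close>. Such functions vanish at all half-periods, and so does, for
  fixed \<open>y\<close>, the theta product \<open>R x y\<close> on the right-hand side, whose only other zeros lie at \<open>x = \<plusminus>y\<close>
  modulo periods. If \<open>2y\<close> is not a period then all these zeros are simple, so that an odd \<open>f\<close> with
  \<open>f y = 0\<close> is divisible by \<open>R \<cdot> y\<close>. The quotient is an entire elliptic function, hence constant. It
  follows that an alternating form which is of this type in each variable and vanishes at one point
  \<open>(u, v)\<close> with \<open>R u v \<noteq> 0\<close> is zero; subtracting a suitable multiple of \<open>R\<close> from the left-hand side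
  gives such a form.

  The same quotient argument finds the zeros of \<open>\<theta>\<^sub>1\<close>, as it shows that \<open>\<theta>\<^sub>1\<close> is a constant multiple of
  the triple product, whose zeros are those of its factors.
\<close>

section \<open>Period lattices\<close>

definition period_lattice :: "complex \<Rightarrow> complex \<Rightarrow> complex set" where
  "period_lattice \<omega>\<^sub>1 \<omega>\<^sub>2 = {of_int m * \<omega>\<^sub>1 + of_int n * \<omega>\<^sub>2 | m n. True}"

lemma period_latticeI: "z = of_int m * \<omega>\<^sub>1 + of_int n * \<omega>\<^sub>2 \<Longrightarrow> z \<in> period_lattice \<omega>\<^sub>1 \<omega>\<^sub>2"
  by (auto simp: period_lattice_def)

lemma period_latticeE:
  assumes "z \<in> period_lattice \<omega>\<^sub>1 \<omega>\<^sub>2"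
  obtains m n where "z = of_int m * \<omega>\<^sub>1 + of_int n * \<omega>\<^sub>2"
  using assms by (auto simp: period_lattice_def)

lemma period_lattice_diff:
  assumes "\<omega> \<in> period_lattice \<omega>\<^sub>1 \<omega>\<^sub>2" "\<omega>' \<in> period_lattice \<omega>\<^sub>1 \<omega>\<^sub>2"
  shows "\<omega> - \<omega>' \<in> period_lattice \<omega>\<^sub>1 \<omega>\<^sub>2"
proof -
  obtain m n m' n' where "\<omega> = of_int m * \<omega>\<^sub>1 + of_int n * \<omega>\<^sub>2"
    "\<omega>' = of_int m' * \<omega>\<^sub>1 + of_int n' * \<omega>\<^sub>2"
    using assms by (elim period_latticeE)
  then show ?thesis
    by (intro period_latticeI[of _ "m - m'" _ "n - n'"]) (simp add: algebra_simps)
qed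

lemma periodic_add_lattice:
  fixes f :: "complex \<Rightarrow> 'a"
  assumes "\<And>z. f (z + \<omega>\<^sub>1) = f z" "\<And>z. f (z + \<omega>\<^sub>2) = f z" and "\<omega> \<in> period_lattice \<omega>\<^sub>1 \<omega>\<^sub>2"
  shows "f (z + \<omega>) = f z"
proof -
  interpret p\<^sub>1: periodic_fun_simple f \<omega>\<^sub>1 by standard (rule assms)
  interpret p\<^sub>2: periodic_fun_simple f \<omega>\<^sub>2 by standard (rule assms)
  obtain m n where "\<omega> = of_int m * \<omega>\<^sub>1 + of_int n * \<omega>\<^sub>2"
    using assms(3) by (rule period_latticeE)
  then show ?thesis
    using p\<^sub>2.plus_of_int[of "z + of_int m * \<omega>\<^sub>1" n] p\<^sub>1.plus_of_int[of z m]
    by (simp add: add.assoc)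
qed

lemma real_coordinates:
  assumes "Im (\<omega>\<^sub>2 / \<omega>\<^sub>1) \<noteq> 0"
  obtains s t :: real where "z = of_real s * \<omega>\<^sub>1 + of_real t * \<omega>\<^sub>2"
proof -
  define \<rho> where "\<rho> = \<omega>\<^sub>2 / \<omega>\<^sub>1"
  define w where "w = z / \<omega>\<^sub>1"
  define t where "t = Im w / Im \<rho>"
  have "Im \<rho> \<noteq> 0" "\<omega>\<^sub>1 \<noteq> 0"
    using assms by (auto simp: \<rho>_def)
  then have "w = of_real (Re w - t * Re \<rho>) + of_real t * \<rho>"
    by (simp add: complex_eq_iff t_def)
  from arg_cong[OF this, of "\<lambda>x. x * \<omega>\<^sub>1"]
  have "w * \<omega>\<^sub>1 = of_real (Re w - t * Re \<rho>) * \<omega>\<^sub>1 + of_real t * (\<rho> * \<omega>\<^sub>1)"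
    by (simp only: distrib_right mult.assoc)
  then show ?thesis
    using \<open>\<omega>\<^sub>1 \<noteq> 0\<close> by (intro that[of "Re w - t * Re \<rho>" t]) (simp add: w_def \<rho>_def)
qed

lemma doubly_periodic_entire_constant:
  assumes hol: "f holomorphic_on UNIV" and nondegenerate: "Im (\<omega>\<^sub>2 / \<omega>\<^sub>1) \<noteq> 0"
    and periods: "\<And>z. f (z + \<omega>\<^sub>1) = f z" "\<And>z. f (z + \<omega>\<^sub>2) = f z"
  shows "f constant_on UNIV"
proof -
  define P where "P = (\<lambda>(s, t). of_real s * \<omega>\<^sub>1 + of_real t * \<omega>\<^sub>2) ` ({0..1::real} \<times> {0..1::real})"
  have "f z \<in> f ` P" for z
  proof -
    obtain s t :: real where z: "z = of_real s * \<omega>\<^sub>1 + of_real t * \<omega>\<^sub>2"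
      using real_coordinates[OF nondegenerate] .
    define w where "w = of_real (frac s) * \<omega>\<^sub>1 + of_real (frac t) * \<omega>\<^sub>2"
    have "z = w + (of_int \<lfloor>s\<rfloor> * \<omega>\<^sub>1 + of_int \<lfloor>t\<rfloor> * \<omega>\<^sub>2)"
      by (simp add: z w_def frac_def algebra_simps)
    then have "f z = f w"
      using periodic_add_lattice[of f, OF periods period_latticeI[OF refl]] by simp
    moreover have "w \<in> P"
      unfolding w_def P_def
      by (intro image_eqI[of _ _ "(frac s, frac t)"]) (auto simp: less_imp_le[OF frac_lt_1])
    ultimately show ?thesis by blast
  qed
  moreover have "bounded (f ` P)"
    unfolding P_def
    by (intro compact_imp_bounded compact_continuous_image compact_Times compact_Icc
        continuous_on_subset[OF holomorphic_on_imp_continuous_on[OF hol]])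
      (auto simp: case_prod_unfold intro!: continuous_intros)
  ultimately have "bounded (range f)"
    by (blast intro: bounded_subset)
  with hol show ?thesis
    by (rule Liouville_theorem)
qed


section \<open>Division by entire functions with simple zeros\<close>

lemma entire_compose:
  assumes "f holomorphic_on UNIV" "g holomorphic_on UNIV"
  shows "(\<lambda>z. f (g z)) holomorphic_on UNIV"
  using holomorphic_on_compose_gen[OF assms(2,1)] by (simp add: o_def)

lemma entire_mult_left_cancel:
  assumes "g holomorphic_on UNIV" "h holomorphic_on UNIV" "k holomorphic_on UNIV"
    and "g a \<noteq> 0" and eq: "\<And>z. g z * h z = g z * k z"
  shows "h z = k z"
proof (rule analytic_continuation_open[where s = "{z. g z \<noteq> 0}" and s' = UNIV and f = h and g = k])
  show "open {z. g z \<noteq> 0}"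
    using assms(1) by (intro open_Collect_neq continuous_on_const holomorphic_on_imp_continuous_on)
  show "h z = k z" if "z \<in> {z. g z \<noteq> 0}" for z
    using eq[of z] that by simp
qed (use assms in auto)

definition simple_zeros :: "(complex \<Rightarrow> complex) \<Rightarrow> bool" where
  "simple_zeros g \<longleftrightarrow> (\<forall>z. g z = 0 \<longrightarrow> deriv g z \<noteq> 0)"

lemma simple_zerosI: "(\<And>z. g z = 0 \<Longrightarrow> deriv g z \<noteq> 0) \<Longrightarrow> simple_zeros g"
  and simple_zerosD: "simple_zeros g \<Longrightarrow> g z = 0 \<Longrightarrow> deriv g z \<noteq> 0"
  by (auto simp: simple_zeros_def)

lemma entire_has_deriv: "f holomorphic_on UNIV \<Longrightarrow> (f has_field_derivative deriv f z) (at z)"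
  by (rule holomorphic_derivI[of _ UNIV]) auto

lemma simple_zeros_not_identically_zero:
  assumes "simple_zeros g"
  obtains z where "g z \<noteq> 0"
proof (rule ccontr)
  assume "\<not> thesis"
  then have "g = (\<lambda>_. 0)" using that by blast
  with assms show False by (simp add: simple_zeros_def)
qed

lemma simple_zeros_mult:
  assumes "f holomorphic_on UNIV" "g holomorphic_on UNIV" "simple_zeros f" "simple_zeros g"
    and no_common_zero: "\<And>z. f z = 0 \<Longrightarrow> g z \<noteq> 0"
  shows "simple_zeros (\<lambda>z. f z * g z)"
proof (rule simple_zerosI)
  fix z assume "f z * g z = 0"
  moreover have "deriv (\<lambda>z. f z * g z) z = deriv f z * g z + deriv g z * f z"
    by (intro DERIV_imp_deriv DERIV_mult entire_has_deriv assms)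
  ultimately show "deriv (\<lambda>z. f z * g z) z \<noteq> 0"
    using assms(3,4) no_common_zero[of z] by (auto dest: simple_zerosD)
qed

lemma simple_zeros_affine:
  assumes "f holomorphic_on UNIV" "simple_zeros f" "a \<noteq> 0"
  shows "simple_zeros (\<lambda>z. f (a * z + b))"
proof (rule simple_zerosI)
  fix z assume "f (a * z + b) = 0"
  moreover have "deriv (\<lambda>z. f (a * z + b)) z = deriv f (a * z + b) * a"
    by (intro DERIV_imp_deriv DERIV_chain2[OF entire_has_deriv[OF assms(1)]])
      (auto intro!: derivative_eq_intros)
  ultimately show "deriv (\<lambda>z. f (a * z + b)) z \<noteq> 0"
    using assms(2,3) by (auto dest: simple_zerosD)
qed

lemma simple_zeros_cmult:
  assumes "f holomorphic_on UNIV" "simple_zeros f" "c \<noteq> 0"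
  shows "simple_zeros (\<lambda>z. c * f z)"
proof (rule simple_zerosI)
  fix z assume "c * f z = 0"
  moreover have "deriv (\<lambda>z. c * f z) z = c * deriv f z"
    by (intro DERIV_imp_deriv DERIV_cmult entire_has_deriv assms)
  ultimately show "deriv (\<lambda>z. c * f z) z \<noteq> 0"
    using assms(2,3) by (auto dest: simple_zerosD)
qed

lemma holomorphic_quotient_at_simple_zero:
  assumes hol: "f holomorphic_on UNIV" "g holomorphic_on UNIV"
    and zero: "f a = 0" "g a = 0" and simple: "deriv g a \<noteq> 0"
  obtains k U where "open U" "a \<in> U" "k holomorphic_on U" "k a = deriv f a / deriv g a"
    "\<And>z. z \<in> U \<Longrightarrow> z \<noteq> a \<Longrightarrow> g z \<noteq> 0 \<and> k z = f z / g z"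
proof -
  define f' where "f' = (\<lambda>z. if z = a then deriv f a else (f z - f a) / (z - a))"
  define g' where "g' = (\<lambda>z. if z = a then deriv g a else (g z - g a) / (z - a))"
  have hol': "f' holomorphic_on UNIV" "g' holomorphic_on UNIV"
    unfolding f'_def g'_def by (rule pole_lemma_open; simp add: hol)+
  show ?thesis
  proof
    show "open {z. g' z \<noteq> 0}"
      using hol'(2) by (intro open_Collect_neq continuous_on_const holomorphic_on_imp_continuous_on)
    show "(\<lambda>z. f' z / g' z) holomorphic_on {z. g' z \<noteq> 0}"
      using hol' by (intro holomorphic_intros) (auto intro: holomorphic_on_subset)
  qed (use zero simple in \<open>auto simp: f'_def g'_def\<close>)
qed

lemma entire_quotient_by_simple_zeros:
  assumes hol: "f holomorphic_on UNIV" "g holomorphic_on UNIV" and "simple_zeros g"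
    and zeros: "\<And>z. g z = 0 \<Longrightarrow> f z = 0"
  obtains h where "h holomorphic_on UNIV" "\<And>z. f z = g z * h z"
proof
  let ?h = "\<lambda>z. if g z = 0 then deriv f z / deriv g z else f z / g z"
  show "f z = g z * ?h z" for z
    by (simp add: zeros)
  have "?h field_differentiable at a" for a
  proof (cases "g a = 0")
    case True
    obtain k U where "open U" "a \<in> U" "k holomorphic_on U" and k_at_a: "k a = deriv f a / deriv g a"
      and k_eq: "\<And>z. z \<in> U \<Longrightarrow> z \<noteq> a \<Longrightarrow> g z \<noteq> 0 \<and> k z = f z / g z"
      by (rule holomorphic_quotient_at_simple_zero[OF hol zeros[OF True] True
          simple_zerosD[OF assms(3) True]]) blast
    have "k z = ?h z" if "z \<in> U" for z
      using True k_at_a k_eq[OF that] by (cases "z = a") auto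
    with \<open>k holomorphic_on U\<close> have "?h holomorphic_on U"
      by (rule holomorphic_transform)
    then show ?thesis
      using \<open>open U\<close> \<open>a \<in> U\<close> by (rule holomorphic_on_imp_differentiable_at)
  next
    case False
    have "open {z. g z \<noteq> 0}"
      using hol(2) by (intro open_Collect_neq continuous_on_const holomorphic_on_imp_continuous_on)
    moreover have "(\<lambda>z. f z / g z) holomorphic_on {z. g z \<noteq> 0}"
      using hol by (intro holomorphic_intros) (auto intro: holomorphic_on_subset)
    then have "?h holomorphic_on {z. g z \<noteq> 0}"
      by (rule holomorphic_transform) simp
    ultimately show ?thesis
      using False by (intro holomorphic_on_imp_differentiable_at[of _ "{z. g z \<noteq> 0}"]) auto
  qed
  then show "?h holomorphic_on UNIV"
    by (simp add: holomorphic_on_def field_differentiable_at_within)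
qed


section \<open>Theta functions of given degree and multipliers\<close>

abbreviation theta_lattice :: "complex \<Rightarrow> complex set" where
  "theta_lattice \<tau> \<equiv> period_lattice (of_real pi) (of_real pi * \<tau>)"

definition theta_function ::
    "complex \<Rightarrow> nat \<Rightarrow> complex \<Rightarrow> complex \<Rightarrow> (complex \<Rightarrow> complex) \<Rightarrow> bool" where
  "theta_function \<tau> k \<alpha> \<beta> f \<longleftrightarrow> f holomorphic_on UNIV \<and>
     (\<forall>z. f (z + of_real pi) = \<alpha> * f z) \<and>
     (\<forall>z. f (z + of_real pi * \<tau>) = \<beta> * exp (- 2 * \<i> * of_nat k * z) * f z)"

lemma theta_functionI:
  assumes "f holomorphic_on UNIV" "\<And>z. f (z + of_real pi) = \<alpha> * f z"
    and "\<And>z. f (z + of_real pi * \<tau>) = \<beta> * exp (- 2 * \<i> * of_nat k * z) * f z"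
  shows "theta_function \<tau> k \<alpha> \<beta> f"
  using assms by (simp add: theta_function_def)

lemma theta_functionD:
  assumes "theta_function \<tau> k \<alpha> \<beta> f"
  shows theta_function_holomorphic: "f holomorphic_on UNIV"
    and theta_function_add_pi: "f (z + of_real pi) = \<alpha> * f z"
    and theta_function_add_pi_tau:
      "f (z + of_real pi * \<tau>) = \<beta> * exp (- 2 * \<i> * of_nat k * z) * f z"
  using assms by (simp_all add: theta_function_def)

lemma theta_function_mult:
  assumes "theta_function \<tau> k \<alpha> \<beta> f" "theta_function \<tau> k' \<alpha>' \<beta>' g"
  shows "theta_function \<tau> (k + k') (\<alpha> * \<alpha>') (\<beta> * \<beta>') (\<lambda>z. f z * g z)"
proof (rule theta_functionI)
  show "f (z + of_real pi * \<tau>) * g (z + of_real pi * \<tau>) =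
      \<beta> * \<beta>' * exp (- 2 * \<i> * of_nat (k + k') * z) * (f z * g z)" for z
    unfolding theta_function_add_pi_tau[OF assms(1)] theta_function_add_pi_tau[OF assms(2)]
    by (simp add: algebra_simps flip: exp_add)
qed (simp_all add: theta_functionD(1,2)[OF assms(1)] theta_functionD(1,2)[OF assms(2)]
    holomorphic_on_mult)

lemma theta_function_diff:
  assumes "theta_function \<tau> k \<alpha> \<beta> f" "theta_function \<tau> k \<alpha> \<beta> g"
  shows "theta_function \<tau> k \<alpha> \<beta> (\<lambda>z. f z - g z)"
  by (rule theta_functionI)
    (simp_all add: theta_functionD[OF assms(1)] theta_functionD[OF assms(2)] holomorphic_on_diff
      right_diff_distrib)

lemma theta_function_cmult:
  assumes "theta_function \<tau> k \<alpha> \<beta> f"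
  shows "theta_function \<tau> k \<alpha> \<beta> (\<lambda>z. c * f z)"
  by (rule theta_functionI) (simp_all add: theta_functionD[OF assms] holomorphic_intros)

lemma theta_function_translate:
  assumes "theta_function \<tau> k \<alpha> \<beta> f"
  shows "theta_function \<tau> k \<alpha> (\<beta> * exp (- 2 * \<i> * of_nat k * c)) (\<lambda>z. f (z + c))"
proof (rule theta_functionI)
  show "(\<lambda>z. f (z + c)) holomorphic_on UNIV"
    by (intro entire_compose[OF theta_function_holomorphic[OF assms]] holomorphic_intros)
  show "f (z + of_real pi + c) = \<alpha> * f (z + c)" for z
    using theta_function_add_pi[OF assms, of "z + c"] by (simp add: ac_simps)
  show "f (z + of_real pi * \<tau> + c) =
      \<beta> * exp (- 2 * \<i> * of_nat k * c) * exp (- 2 * \<i> * of_nat k * z) * f (z + c)" for z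
    using theta_function_add_pi_tau[OF assms, of "z + c"]
    by (simp add: algebra_simps flip: exp_add)
qed

lemma theta_function_double:
  assumes "theta_function \<tau> k \<alpha> \<beta> f"
  shows "theta_function \<tau> (4 * k) (\<alpha>\<^sup>2)
    (\<beta>\<^sup>2 * exp (- 2 * \<i> * of_nat k * (of_real pi * \<tau>))) (\<lambda>z. f (2 * z))"
proof (rule theta_functionI)
  show "(\<lambda>z. f (2 * z)) holomorphic_on UNIV"
    by (intro entire_compose[OF theta_function_holomorphic[OF assms]] holomorphic_intros)
  have double: "2 * (z + \<omega>) = 2 * z + \<omega> + \<omega>" for z \<omega> :: complex
    by simp
  show "f (2 * (z + of_real pi)) = \<alpha>\<^sup>2 * f (2 * z)" for z
    unfolding double by (simp only: theta_function_add_pi[OF assms] power2_eq_square mult.assoc)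
  show "f (2 * (z + of_real pi * \<tau>)) = \<beta>\<^sup>2 * exp (- 2 * \<i> * of_nat k * (of_real pi * \<tau>))
      * exp (- 2 * \<i> * of_nat (4 * k) * z) * f (2 * z)" for z
    unfolding double theta_function_add_pi_tau[OF assms]
    by (simp add: power2_eq_square ring_distribs mult_ac flip: exp_add)
qed

lemma theta_function_reflect:
  assumes "theta_function \<tau> k \<alpha> \<beta> f" "\<alpha> \<noteq> 0" "\<beta> \<noteq> 0"
  shows "theta_function \<tau> k (inverse \<alpha>)
    (inverse \<beta> * exp (- 2 * \<i> * of_nat k * (of_real pi * \<tau>))) (\<lambda>z. f (- z))"
proof (rule theta_functionI)
  show "(\<lambda>z. f (- z)) holomorphic_on UNIV"
    by (intro entire_compose[OF theta_function_holomorphic[OF assms(1)]] holomorphic_intros)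
  show "f (- (z + of_real pi)) = inverse \<alpha> * f (- z)" for z
    using theta_function_add_pi[OF assms(1), of "- z - of_real pi"] \<open>\<alpha> \<noteq> 0\<close> by simp
  show "f (- (z + of_real pi * \<tau>)) = inverse \<beta> * exp (- 2 * \<i> * of_nat k * (of_real pi * \<tau>))
      * exp (- 2 * \<i> * of_nat k * z) * f (- z)" for z
    using theta_function_add_pi_tau[OF assms(1), of "- z - of_real pi * \<tau>"] \<open>\<beta> \<noteq> 0\<close>
    by (simp add: algebra_simps flip: exp_add)
qed

lemma theta_function_zero_add_lattice:
  assumes "theta_function \<tau> k \<alpha> \<beta> f" "\<alpha> \<noteq> 0" "\<beta> \<noteq> 0" "\<omega> \<in> theta_lattice \<tau>"
  shows "f (z + \<omega>) = 0 \<longleftrightarrow> f z = 0"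
  using assms(2,3)
  by (intro periodic_add_lattice[of "\<lambda>z. f z = 0", OF _ _ assms(4)])
    (simp_all add: theta_functionD[OF assms(1)])

lemma theta_function_deriv_at_zero:
  assumes "theta_function \<tau> k \<alpha> \<beta> f" "f z = 0"
  shows "deriv f (z + of_real pi) = \<alpha> * deriv f z"
    and "deriv f (z + of_real pi * \<tau>) = \<beta> * exp (- 2 * \<i> * of_nat k * z) * deriv f z"
proof -
  note deriv = entire_has_deriv[OF theta_function_holomorphic[OF assms(1)]]
  have shift: "((\<lambda>z. f (z + \<omega>)) has_field_derivative deriv f (z + \<omega>)) (at z)" for \<omega>
    using deriv[of "z + \<omega>"] by (simp add: DERIV_shift)
  have "((\<lambda>z. f (z + of_real pi)) has_field_derivative \<alpha> * deriv f z) (at z)"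
    unfolding theta_function_add_pi[OF assms(1)] by (intro DERIV_cmult deriv)
  then show "deriv f (z + of_real pi) = \<alpha> * deriv f z"
    by (rule DERIV_unique[OF shift])
  have "((\<lambda>z. f (z + of_real pi * \<tau>)) has_field_derivative
      \<beta> * exp (- 2 * \<i> * of_nat k * z) * deriv f z) (at z)"
    unfolding theta_function_add_pi_tau[OF assms(1)]
    using \<open>f z = 0\<close> by (auto intro!: derivative_eq_intros deriv)
  then show "deriv f (z + of_real pi * \<tau>) = \<beta> * exp (- 2 * \<i> * of_nat k * z) * deriv f z"
    by (rule DERIV_unique[OF shift])
qed

lemma theta_function_simple_zeros:
  assumes "theta_function \<tau> k \<alpha> \<beta> f" "\<alpha> \<noteq> 0" "\<beta> \<noteq> 0"
    and zeros: "\<And>z. f z = 0 \<Longrightarrow> z \<in> theta_lattice \<tau>" and "deriv f 0 \<noteq> 0"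
  shows "simple_zeros f"
proof (rule simple_zerosI)
  fix z assume "f z = 0"
  let ?multiple = "\<lambda>z. f z = 0 \<and> deriv f z = 0"
  have "?multiple (0 + z) \<longleftrightarrow> ?multiple 0"
    using assms(2,3)
    by (intro periodic_add_lattice[of ?multiple, OF _ _ zeros[OF \<open>f z = 0\<close>]])
      (auto simp: theta_functionD[OF assms(1)] theta_function_deriv_at_zero[OF assms(1)])
  with \<open>f z = 0\<close> \<open>deriv f 0 \<noteq> 0\<close> show "deriv f z \<noteq> 0"
    by simp
qed

lemma theta_function_constant_multiple:
  assumes f: "theta_function \<tau> k \<alpha> \<beta> f" and g: "theta_function \<tau> k \<alpha> \<beta> g" and "Im \<tau> \<noteq> 0"
    and simple: "simple_zeros g" and zeros: "\<And>z. g z = 0 \<Longrightarrow> f z = 0"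
  shows "\<exists>c. \<forall>z. f z = c * g z"
proof -
  note g_holomorphic = theta_function_holomorphic[OF g]
  obtain h where h_holomorphic: "h holomorphic_on UNIV" and f_eq: "\<And>z. f z = g z * h z"
    using entire_quotient_by_simple_zeros[OF theta_function_holomorphic[OF f] g_holomorphic
        simple zeros] by blast
  obtain a where "g a \<noteq> 0"
    using simple by (rule simple_zeros_not_identically_zero)
  have periodic: "h (z + \<omega>) = h z"
    if "\<And>z. f (z + \<omega>) = m z * f z" and "\<And>z. g (z + \<omega>) = m z * g z" for \<omega> m z
  proof (rule entire_mult_left_cancel[of "\<lambda>z. g (z + \<omega>)" "\<lambda>z. h (z + \<omega>)" h "a - \<omega>"])
    show "g (z + \<omega>) * h (z + \<omega>) = g (z + \<omega>) * h z" for z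
      using that[of z] by (simp only: f_eq mult.assoc)
  qed (use \<open>g a \<noteq> 0\<close> g_holomorphic h_holomorphic in
      \<open>auto intro!: entire_compose[where f = g] entire_compose[where f = h] holomorphic_intros\<close>)
  have "h (z + of_real pi) = h z" for z
    by (rule periodic[OF theta_function_add_pi[OF f] theta_function_add_pi[OF g]])
  moreover have "h (z + of_real pi * \<tau>) = h z" for z
    by (rule periodic[OF theta_function_add_pi_tau[OF f] theta_function_add_pi_tau[OF g]])
  ultimately have "h constant_on UNIV"
    using \<open>Im \<tau> \<noteq> 0\<close>
    by (intro doubly_periodic_entire_constant[of h "of_real pi * \<tau>" "of_real pi"] h_holomorphic)
      auto
  then obtain c where "\<And>z. h z = c"
    by (auto simp: constant_on_def)
  then show ?thesis
    by (intro exI[of _ c]) (simp add: f_eq mult.commute)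
qed


section \<open>The triple product\<close>

lemma holomorphic_on_prodinf:
  fixes f :: "nat \<Rightarrow> complex \<Rightarrow> complex"
  assumes "open S" and hol: "\<And>n. f n holomorphic_on S"
    and conv: "\<And>K. compact K \<Longrightarrow> K \<subseteq> S \<Longrightarrow> uniformly_convergent_on K (\<lambda>N z. \<Sum>n<N. norm (f n z - 1))"
  shows "(\<lambda>z. \<Prod>n. f n z) holomorphic_on S"
proof (rule holomorphic_uniform_sequence[OF \<open>open S\<close>])
  show "(\<lambda>z. \<Prod>n<N. f n z) holomorphic_on S" for N
    by (intro holomorphic_intros hol)
  fix z assume "z \<in> S"
  with \<open>open S\<close> obtain d where "d > 0" and K: "cball z d \<subseteq> S"
    by (auto simp: open_contains_cball)
  have limit: "(\<lambda>N. \<Prod>n<N. f n w) \<longlonglongrightarrow> (\<Prod>n. f n w)" if "w \<in> cball z d" for w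
  proof -
    have "convergent (\<lambda>N. \<Sum>n<N. norm (f n w - 1))"
      using uniformly_convergent_imp_convergent[OF conv[OF compact_cball K] that] .
    then have "convergent_prod (\<lambda>n. f n w)"
      by (intro abs_convergent_prod_imp_convergent_prod summable_imp_abs_convergent_prod)
        (simp add: summable_iff_convergent)
    then show ?thesis
      by (intro has_prod_imp_tendsto' convergent_prod_has_prod)
  qed
  have "uniformly_convergent_on (cball z d) (\<lambda>N w. \<Prod>n<N. f n w)"
    using K by (intro uniformly_convergent_on_prod' conv compact_cball
        holomorphic_on_imp_continuous_on holomorphic_on_subset[OF hol])
  then have "uniform_limit (cball z d) (\<lambda>N w. \<Prod>n<N. f n w) (\<lambda>w. lim (\<lambda>N. \<Prod>n<N. f n w)) sequentially"
    by (simp add: uniformly_convergent_uniform_limit_iff)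
  then have "uniform_limit (cball z d) (\<lambda>N w. \<Prod>n<N. f n w) (\<lambda>w. \<Prod>n. f n w) sequentially"
    by (rule uniform_limit_cong'[THEN iffD1, rotated 2]) (use limI[OF limit] in auto)
  with \<open>d > 0\<close> K show "\<exists>d>0. cball z d \<subseteq> S \<and>
      uniform_limit (cball z d) (\<lambda>N w. \<Prod>n<N. f n w) (\<lambda>w. \<Prod>n. f n w) sequentially"
    by blast
qed

definition q_pochhammer :: "complex \<Rightarrow> complex \<Rightarrow> complex" where
  "q_pochhammer q w = (\<Prod>n. 1 - w * q ^ n)"

lemma has_prod_q_pochhammer:
  assumes "norm q < 1"
  shows "(\<lambda>n. 1 - w * q ^ n) has_prod q_pochhammer q w"
proof -
  have "summable (\<lambda>n. norm (1 - w * q ^ n - 1))"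
    using assms by (simp add: norm_mult norm_power summable_mult summable_geometric)
  then have "convergent_prod (\<lambda>n. 1 - w * q ^ n)"
    by (intro abs_convergent_prod_imp_convergent_prod summable_imp_abs_convergent_prod)
  then show ?thesis
    unfolding q_pochhammer_def by (rule convergent_prod_has_prod)
qed

lemma q_pochhammer_eq_0_iff:
  assumes "norm q < 1"
  shows "q_pochhammer q w = 0 \<longleftrightarrow> (\<exists>n. w * q ^ n = 1)"
  using has_prod_eq_0_iff[OF has_prod_q_pochhammer[OF assms], of w] by auto

lemma q_pochhammer_rec:
  assumes "norm q < 1"
  shows "q_pochhammer q w = (1 - w) * q_pochhammer q (w * q)"
proof (cases "w = 1")
  case True
  then show ?thesis
    using assms by (auto simp: q_pochhammer_eq_0_iff intro: exI[of _ 0])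
next
  case False
  have "(\<lambda>n. 1 - w * q ^ Suc n) has_prod q_pochhammer q (w * q)"
    using has_prod_q_pochhammer[OF assms, of "w * q"] by (simp add: mult_ac)
  then have "(\<lambda>n. 1 - w * q ^ n) has_prod (q_pochhammer q (w * q) * (1 - w))"
    using False has_prod_Suc_iff[of "\<lambda>n. 1 - w * q ^ n"] by simp
  then show ?thesis
    using has_prod_unique2[OF has_prod_q_pochhammer[OF assms]] by (simp add: mult.commute)
qed

lemma holomorphic_q_pochhammer:
  assumes "norm q < 1"
  shows "q_pochhammer q holomorphic_on UNIV"
  unfolding q_pochhammer_def[abs_def]
proof (rule holomorphic_on_prodinf)
  fix K :: "complex set" assume "compact K"
  obtain B where "\<And>w. w \<in> K \<Longrightarrow> norm w \<le> B"
    using compact_imp_bounded[OF \<open>compact K\<close>] by (auto simp: bounded_iff)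
  then have "norm (norm (1 - w * q ^ n - 1)) \<le> B * norm q ^ n" if "w \<in> K" for w n
    using that by (simp add: norm_mult norm_power mult_right_mono)
  then show "uniformly_convergent_on K (\<lambda>N w. \<Sum>n<N. norm (1 - w * q ^ n - 1))"
    using assms by (intro Weierstrass_m_test'[where M = "\<lambda>n. B * norm q ^ n"])
      (auto intro!: summable_mult summable_geometric)
qed (auto intro!: holomorphic_intros)

lemma qpow_add: "qpow \<tau> (a + b) = qpow \<tau> a * qpow \<tau> b"
  by (simp add: qpow_def algebra_simps flip: exp_add)

lemma qpow_minus: "qpow \<tau> (- a) = inverse (qpow \<tau> a)"
  by (simp add: qpow_def exp_minus)

lemma qpow_nonzero [simp]: "qpow \<tau> a \<noteq> 0"
  by (simp add: qpow_def)

lemma qpow_of_nat: "qpow \<tau> (real n) = qpow \<tau> 1 ^ n"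
  unfolding qpow_def by (subst exp_of_nat_mult[symmetric]) (simp add: mult_ac)

lemma norm_qpow_1_less_1: "Im \<tau> > 0 \<Longrightarrow> norm (qpow \<tau> 1) < 1"
  by (simp add: qpow_def norm_exp_eq_Re)

lemma exp_2_i_eq_1_iff: "exp (2 * \<i> * z) = 1 \<longleftrightarrow> (\<exists>m::int. z = of_int m * of_real pi)"
proof -
  have "exp (2 * \<i> * z) = 1 \<longleftrightarrow> Im z = 0 \<and> (\<exists>m::int. Re z = of_int m * pi)"
    unfolding exp_eq_1 by simp
  then show ?thesis
    by (auto simp: complex_eq_iff)
qed

lemma theta_lattice_iff:
  "z \<in> theta_lattice \<tau> \<longleftrightarrow> (\<exists>n::int. exp (2 * \<i> * z) * qpow \<tau> (of_int n) = 1)"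
proof -
  have combine: "exp (2 * \<i> * z) * qpow \<tau> (of_int n) =
      exp (2 * \<i> * (z + of_int n * (of_real pi * \<tau>)))" for n
    by (simp add: qpow_def algebra_simps flip: exp_add)
  show ?thesis
    unfolding combine exp_2_i_eq_1_iff
  proof
    assume "z \<in> theta_lattice \<tau>"
    then obtain m n where "z = of_int m * of_real pi + of_int n * (of_real pi * \<tau>)"
      by (rule period_latticeE)
    then show "\<exists>n m. z + of_int n * (of_real pi * \<tau>) = of_int m * of_real pi"
      by (intro exI[of _ "- n"] exI[of _ m]) simp
  next
    assume "\<exists>n m. z + of_int n * (of_real pi * \<tau>) = of_int m * of_real pi"
    then obtain m n where "z + of_int n * (of_real pi * \<tau>) = of_int m * of_real pi"
      by blast
    then show "z \<in> theta_lattice \<tau>"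
      by (intro period_latticeI[of _ m _ "- n"]) (simp add: eq_diff_eq)
  qed
qed

definition theta_product :: "complex \<Rightarrow> complex \<Rightarrow> complex" where
  "theta_product \<tau> z = exp (- \<i> * z) * q_pochhammer (qpow \<tau> 1) (exp (2 * \<i> * z)) *
     q_pochhammer (qpow \<tau> 1) (exp (- 2 * \<i> * z) * qpow \<tau> 1)"

lemma holomorphic_theta_product:
  assumes "Im \<tau> > 0"
  shows "theta_product \<tau> holomorphic_on UNIV"
  unfolding theta_product_def[abs_def]
  by (intro holomorphic_intros
      entire_compose[OF holomorphic_q_pochhammer[OF norm_qpow_1_less_1[OF assms]]])

lemma theta_product_add_pi: "theta_product \<tau> (z + of_real pi) = - theta_product \<tau> z"
proof -
  have "exp (2 * \<i> * of_real pi) = 1"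
    unfolding exp_2_i_eq_1_iff by (rule exI[of _ 1]) simp
  then have "exp (- \<i> * (z + of_real pi)) = - exp (- \<i> * z)"
    "exp (2 * \<i> * (z + of_real pi)) = exp (2 * \<i> * z)"
    "exp (- 2 * \<i> * (z + of_real pi)) = exp (- 2 * \<i> * z)"
    by (simp_all add: distrib_left exp_add exp_diff exp_minus)
  then show ?thesis
    by (simp add: theta_product_def)
qed

lemma theta_product_add_pi_tau:
  assumes "Im \<tau> > 0"
  shows "theta_product \<tau> (z + of_real pi * \<tau>) =
    - qpow \<tau> (- 1/2) * exp (- 2 * \<i> * z) * theta_product \<tau> z"
proof -
  let ?q = "qpow \<tau> 1" and ?p = "q_pochhammer (qpow \<tau> 1)"
  note rec = q_pochhammer_rec[OF norm_qpow_1_less_1[OF assms]]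
  define w where "w = exp (2 * \<i> * z)"
  have "w \<noteq> 0" and inverse_w: "exp (- 2 * \<i> * z) = inverse w"
    by (simp_all add: w_def exp_minus)
  have "exp (- \<i> * (z + of_real pi * \<tau>)) = qpow \<tau> (- 1/2) * exp (- \<i> * z)"
    "exp (2 * \<i> * (z + of_real pi * \<tau>)) = w * ?q"
    "exp (- 2 * \<i> * (z + of_real pi * \<tau>)) * ?q = inverse w"
    by (simp_all add: w_def qpow_def algebra_simps flip: exp_add exp_minus)
  then have "theta_product \<tau> (z + of_real pi * \<tau>) =
      qpow \<tau> (- 1/2) * exp (- \<i> * z) * ?p (w * ?q) * ?p (inverse w)"
    unfolding theta_product_def by (simp only:)
  also have "?p (inverse w) = - inverse w * (1 - w) * ?p (inverse w * ?q)"
    using \<open>w \<noteq> 0\<close> by (subst rec) (simp add: field_simps)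
  also have "qpow \<tau> (- 1/2) * exp (- \<i> * z) * ?p (w * ?q) *
        (- inverse w * (1 - w) * ?p (inverse w * ?q)) =
      - qpow \<tau> (- 1/2) * inverse w * (exp (- \<i> * z) * ?p w * ?p (inverse w * ?q))"
    by (simp add: rec[of w] mult_ac)
  finally show ?thesis
    by (simp only: theta_product_def inverse_w flip: w_def)
qed

lemma theta_function_theta_product:
  assumes "Im \<tau> > 0"
  shows "theta_function \<tau> 1 (- 1) (- qpow \<tau> (- 1/2)) (theta_product \<tau>)"
  by (rule theta_functionI)
    (simp_all add: holomorphic_theta_product theta_product_add_pi theta_product_add_pi_tau assms)

lemma theta_product_eq_0_imp_lattice:
  assumes "Im \<tau> > 0" and zero: "theta_product \<tau> z = 0"
  shows "z \<in> theta_lattice \<tau>"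
proof -
  note q = norm_qpow_1_less_1[OF assms(1)]
  consider (lower) n where "exp (2 * \<i> * z) * qpow \<tau> 1 ^ n = 1"
    | (upper) n where "exp (- 2 * \<i> * z) * qpow \<tau> 1 ^ Suc n = 1"
    using zero by (auto simp: theta_product_def q_pochhammer_eq_0_iff[OF q] mult.assoc)
  then show ?thesis
  proof cases
    case lower
    then have "exp (2 * \<i> * z) * qpow \<tau> (of_int (int n)) = 1"
      by (simp add: qpow_of_nat)
    then show ?thesis
      unfolding theta_lattice_iff by blast
  next
    case upper
    then have "inverse (exp (- 2 * \<i> * z) * qpow \<tau> (real (Suc n))) = 1"
      by (simp only: qpow_of_nat inverse_1)
    then have "exp (2 * \<i> * z) * qpow \<tau> (- real (Suc n)) = 1"
      by (simp add: qpow_minus exp_minus del: of_nat_Suc)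
    then have "exp (2 * \<i> * z) * qpow \<tau> (of_int (- int (Suc n))) = 1"
      by (simp only: of_int_minus of_int_of_nat_eq)
    then show ?thesis
      unfolding theta_lattice_iff by blast
  qed
qed

lemma deriv_theta_product_0:
  assumes "Im \<tau> > 0"
  shows "deriv (theta_product \<tau>) 0 \<noteq> 0"
proof -
  note q = norm_qpow_1_less_1[OF assms]
  let ?p = "q_pochhammer (qpow \<tau> 1)"
  define u where "u = (\<lambda>z. exp (- \<i> * z) * ?p (exp (2 * \<i> * z) * qpow \<tau> 1) *
    ?p (exp (- 2 * \<i> * z) * qpow \<tau> 1))"
  have "u holomorphic_on UNIV"
    unfolding u_def by (intro holomorphic_intros entire_compose[OF holomorphic_q_pochhammer[OF q]])
  then have "((\<lambda>z. (1 - exp (2 * \<i> * z)) * u z) has_field_derivative - 2 * \<i> * u 0) (at 0)"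
    by (auto intro!: derivative_eq_intros entire_has_deriv)
  moreover have "theta_product \<tau> = (\<lambda>z. (1 - exp (2 * \<i> * z)) * u z)"
    unfolding theta_product_def[abs_def] u_def
    by (subst q_pochhammer_rec[OF q, of "exp (2 * \<i> * _)"]) (simp add: mult_ac)
  ultimately have "deriv (theta_product \<tau>) 0 = - 2 * \<i> * u 0"
    by (simp add: DERIV_imp_deriv)
  moreover have "qpow \<tau> 1 * qpow \<tau> 1 ^ n \<noteq> 1" for n
  proof -
    have "norm (qpow \<tau> 1 ^ Suc n) < 1"
      unfolding norm_power by (intro power_less_one_iff[THEN iffD2]) (use q in auto)
    then show ?thesis by auto
  qed
  then have "u 0 \<noteq> 0"
    by (simp add: u_def q_pochhammer_eq_0_iff[OF q])
  ultimately show ?thesis by simp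
qed

lemma simple_zeros_theta_product:
  assumes "Im \<tau> > 0"
  shows "simple_zeros (theta_product \<tau>)"
  using theta_function_simple_zeros[OF theta_function_theta_product[OF assms]]
    theta_product_eq_0_imp_lattice[OF assms] deriv_theta_product_0[OF assms] by simp


section \<open>The theta function \<open>\<theta>\<^sub>1\<close>\<close>

definition theta_coeff :: "complex \<Rightarrow> nat \<Rightarrow> complex" where
  "theta_coeff \<tau> n = (- 1) ^ n * qpow \<tau> ((2 * real n + 1)\<^sup>2 / 8)"

definition theta_series :: "complex \<Rightarrow> complex \<Rightarrow> complex" where
  "theta_series \<tau> w = (\<Sum>n. theta_coeff \<tau> n * w ^ n)"

lemma theta_coeff_0_nonzero: "theta_coeff \<tau> 0 \<noteq> 0"
  by (simp add: theta_coeff_def)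

lemma theta_coeff_Suc: "theta_coeff \<tau> (Suc n) = - (qpow \<tau> 1 ^ Suc n * theta_coeff \<tau> n)"
proof -
  have "(2 * real (Suc n) + 1)\<^sup>2 / 8 = real (Suc n) + (2 * real n + 1)\<^sup>2 / 8"
    by (simp add: power2_eq_square field_simps)
  then show ?thesis
    unfolding theta_coeff_def by (simp only: qpow_add qpow_of_nat) simp
qed

lemma summable_theta_series:
  assumes "Im \<tau> > 0"
  shows "summable (\<lambda>n. theta_coeff \<tau> n * w ^ n)"
proof -
  have "(\<lambda>n. norm (qpow \<tau> 1) ^ Suc n * norm w) \<longlonglongrightarrow> 0 * norm w"
    by (intro tendsto_mult tendsto_const LIMSEQ_Suc LIMSEQ_power_zero)
       (simp add: norm_qpow_1_less_1 assms)
  then have "eventually (\<lambda>n. norm (qpow \<tau> 1) ^ Suc n * norm w < 1/2) sequentially"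
    by (rule order_tendstoD) simp
  then obtain N where N: "\<And>n. n \<ge> N \<Longrightarrow> norm (qpow \<tau> 1) ^ Suc n * norm w < 1/2"
    by (auto simp: eventually_sequentially)
  show ?thesis
  proof (rule summable_ratio_test)
    fix n assume "n \<ge> N"
    have "norm (theta_coeff \<tau> (Suc n) * w ^ Suc n) =
        (norm (qpow \<tau> 1) ^ Suc n * norm w) * norm (theta_coeff \<tau> n * w ^ n)"
      by (simp add: theta_coeff_Suc norm_mult norm_power)
    also have "\<dots> \<le> 1/2 * norm (theta_coeff \<tau> n * w ^ n)"
      using N[OF \<open>n \<ge> N\<close>] by (intro mult_right_mono) auto
    finally show "norm (theta_coeff \<tau> (Suc n) * w ^ Suc n) \<le> 1/2 * norm (theta_coeff \<tau> n * w ^ n)" .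
  qed simp
qed

lemma holomorphic_theta_series:
  assumes "Im \<tau> > 0"
  shows "theta_series \<tau> holomorphic_on UNIV"
proof -
  have "theta_series \<tau> field_differentiable at w" for w
    using termdiffs_strong_converges_everywhere[OF summable_theta_series[OF assms]]
    unfolding field_differentiable_def theta_series_def[abs_def] by blast
  then show ?thesis
    by (simp add: holomorphic_on_def field_differentiable_at_within)
qed

lemma theta_series_rec:
  assumes "Im \<tau> > 0"
  shows "theta_series \<tau> w = theta_coeff \<tau> 0 - qpow \<tau> 1 * w * theta_series \<tau> (qpow \<tau> 1 * w)"
proof -
  let ?q = "qpow \<tau> 1"
  have "theta_coeff \<tau> (Suc n) * w ^ Suc n = - (?q * w) * (theta_coeff \<tau> n * (?q * w) ^ n)" for n
    by (simp add: theta_coeff_Suc power_mult_distrib)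
  then have "(\<Sum>n. theta_coeff \<tau> (Suc n) * w ^ Suc n) = - (?q * w) * theta_series \<tau> (?q * w)"
    unfolding theta_series_def
    by (simp only: suminf_mult[OF summable_theta_series[OF assms]])
  then show ?thesis
    using suminf_split_head[OF summable_theta_series[OF assms], of w]
    by (simp add: theta_series_def algebra_simps)
qed

lemma sin_odd_multiple:
  fixes z :: complex
  defines "s \<equiv> exp (\<i> * z)"
  shows "sin ((2 * of_nat n + 1) * z) = - \<i> / 2 * (s * (s\<^sup>2) ^ n - inverse s * ((inverse s)\<^sup>2) ^ n)"
proof -
  have "exp (\<i> * ((2 * of_nat n + 1) * z)) = s * (s\<^sup>2) ^ n"
    unfolding s_def by (simp flip: exp_of_nat_mult exp_add power_mult) (simp add: algebra_simps)
  moreover have "exp (- (\<i> * ((2 * of_nat n + 1) * z))) = inverse s * ((inverse s)\<^sup>2) ^ n"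
    unfolding s_def
    by (simp flip: exp_of_nat_mult exp_add power_mult exp_minus) (simp add: algebra_simps)
  ultimately show ?thesis
    by (simp only: sin_exp_eq) (simp add: divide_i right_diff_distrib flip: divide_divide_eq_left)
qed

lemma theta1_eq_theta_series:
  assumes "Im \<tau> > 0"
  shows "theta1 z \<tau> = - \<i> * (exp (\<i> * z) * theta_series \<tau> (exp (\<i> * z) ^ 2)
      - inverse (exp (\<i> * z)) * theta_series \<tau> (inverse (exp (\<i> * z)) ^ 2))"
proof -
  define s where "s = exp (\<i> * z)"
  have summand: "(- 1) ^ n * qpow \<tau> ((2 * real n + 1)\<^sup>2 / 8) * sin ((2 * of_nat n + 1) * z) =
      (- \<i> / 2) * (s * (theta_coeff \<tau> n * (s\<^sup>2) ^ n)
        - inverse s * (theta_coeff \<tau> n * ((inverse s)\<^sup>2) ^ n))" for n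
    unfolding sin_odd_multiple theta_coeff_def s_def by (simp add: algebra_simps)
  note sums = summable_sums[OF summable_theta_series[OF assms], folded theta_series_def]
  have "(\<lambda>n. (- 1) ^ n * qpow \<tau> ((2 * real n + 1)\<^sup>2 / 8) * sin ((2 * of_nat n + 1) * z)) sums
      ((- \<i> / 2) * (s * theta_series \<tau> (s\<^sup>2) - inverse s * theta_series \<tau> ((inverse s)\<^sup>2)))"
    unfolding summand by (intro sums_mult sums_diff sums)
  then show ?thesis
    by (simp add: theta1_def s_def sums_unique[symmetric] field_simps)
qed

lemma holomorphic_theta1:
  assumes "Im \<tau> > 0"
  shows "(\<lambda>z. theta1 z \<tau>) holomorphic_on UNIV"
  unfolding theta1_eq_theta_series[OF assms]
  by (intro holomorphic_intros entire_compose[OF holomorphic_theta_series[OF assms]]) auto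

lemma theta1_minus: "Im \<tau> > 0 \<Longrightarrow> theta1 (- z) \<tau> = - theta1 z \<tau>"
  by (simp add: theta1_eq_theta_series exp_minus algebra_simps)

lemma theta1_add_pi: "Im \<tau> > 0 \<Longrightarrow> theta1 (z + of_real pi) \<tau> = - theta1 z \<tau>"
  by (simp add: theta1_eq_theta_series distrib_left exp_add algebra_simps)

lemma theta1_add_pi_tau:
  assumes "Im \<tau> > 0"
  shows "theta1 (z + of_real pi * \<tau>) \<tau> = - qpow \<tau> (- 1/2) * exp (- 2 * \<i> * z) * theta1 z \<tau>"
proof -
  define s where "s = exp (\<i> * z)"
  define p where "p = exp (\<i> * (of_real pi * \<tau>))"
  have nonzero: "s \<noteq> 0" "p \<noteq> 0" by (simp_all add: s_def p_def)
  have q: "qpow \<tau> 1 = p\<^sup>2" "qpow \<tau> (- 1/2) = inverse p"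
    by (simp_all add: qpow_def p_def mult_ac flip: exp_double exp_minus)
  have inverse_s: "exp (- 2 * \<i> * z) = inverse s ^ 2"
    by (simp add: s_def mult_ac flip: exp_double exp_minus)
  have s_shift: "exp (\<i> * (z + of_real pi * \<tau>)) = s * p"
    by (simp add: s_def p_def distrib_left exp_add)
  let ?T = "theta_series \<tau>" and ?c = "theta_coeff \<tau> 0"
  have "?T (s\<^sup>2) = ?c - p\<^sup>2 * s\<^sup>2 * ?T ((s * p)\<^sup>2)"
    using theta_series_rec[OF assms, of "s\<^sup>2"] by (simp add: q power_mult_distrib mult_ac)
  then have outer: "?T ((s * p)\<^sup>2) = (?c - ?T (s\<^sup>2)) / (p\<^sup>2 * s\<^sup>2)"
    using nonzero by (simp add: field_simps)
  have inner: "?T ((inverse (s * p))\<^sup>2) = ?c - inverse s ^ 2 * ?T ((inverse s)\<^sup>2)"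
    using theta_series_rec[OF assms, of "(inverse (s * p))\<^sup>2"] nonzero
    by (simp add: q power_mult_distrib power_inverse field_simps)
  show ?thesis
    unfolding theta1_eq_theta_series[OF assms] s_shift inverse_s q s_def[symmetric] outer inner
    using nonzero by (simp add: field_simps power2_eq_square)
qed

lemma theta_function_theta1:
  assumes "Im \<tau> > 0"
  shows "theta_function \<tau> 1 (- 1) (- qpow \<tau> (- 1/2)) (\<lambda>z. theta1 z \<tau>)"
  by (rule theta_functionI) (simp_all add: holomorphic_theta1 theta1_add_pi theta1_add_pi_tau assms)

lemma entire_inversion_imp_eq_0:
  assumes hol: "f holomorphic_on UNIV" and inversion: "\<And>w. w \<noteq> 0 \<Longrightarrow> f w = inverse w * f (inverse w)"
  shows "f z = 0"
proof (rule Liouville_weak_0[OF hol])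
  have "isCont f 0"
    using holomorphic_on_imp_continuous_on[OF hol] by (simp add: continuous_on_eq_continuous_at)
  then have "f \<midarrow>0\<rightarrow> f 0"
    by (simp add: isCont_def)
  moreover have "filterlim inverse (at (0::complex)) at_infinity"
    using filterlim_inverse_at_iff[of "\<lambda>w::complex. w"] by (simp add: filterlim_ident)
  ultimately have "((\<lambda>w. f (inverse w)) \<longlongrightarrow> f 0) at_infinity"
    by (rule filterlim_compose)
  from tendsto_mult[OF tendsto_inverse_0 this]
  have "((\<lambda>w. inverse w * f (inverse w)) \<longlongrightarrow> 0) at_infinity"
    by simp
  moreover have "eventually (\<lambda>w. f w = inverse w * f (inverse w)) at_infinity"
    using eventually_not_equal_at_infinity[of 0] by eventually_elim (rule inversion)
  ultimately show "(f \<longlongrightarrow> 0) at_infinity"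
    by (simp add: tendsto_cong)
qed

lemma theta1_not_identically_zero:
  assumes "Im \<tau> > 0"
  obtains z where "theta1 z \<tau> \<noteq> 0"
proof (rule ccontr)
  assume "\<not> thesis"
  then have zero: "theta1 z \<tau> = 0" for z using that by blast
  let ?T = "theta_series \<tau>"
  have "?T w = inverse w * ?T (inverse w)" if "w \<noteq> 0" for w
  proof -
    define s where "s = csqrt w"
    have s: "s\<^sup>2 = w" "s \<noteq> 0" using that by (auto simp: s_def)
    have "exp (\<i> * (- \<i> * Ln s)) = s" using s by simp
    then have "s * ?T (s\<^sup>2) = inverse s * ?T ((inverse s)\<^sup>2)"
      using zero[of "- \<i> * Ln s"] unfolding theta1_eq_theta_series[OF assms] by simp
    then have "?T (s\<^sup>2) = inverse (s\<^sup>2) * ?T (inverse (s\<^sup>2))"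
      using s(2) by (simp add: field_simps power2_eq_square)
    then show ?thesis by (simp add: s)
  qed
  then have "?T 0 = 0"
    by (rule entire_inversion_imp_eq_0[OF holomorphic_theta_series[OF assms]])
  then show False
    using theta_coeff_0_nonzero by (simp add: theta_series_def powser_zero)
qed

lemma theta1_lattice_eq_0:
  assumes "Im \<tau> > 0" "z \<in> theta_lattice \<tau>"
  shows "theta1 z \<tau> = 0"
proof -
  have "theta1 0 \<tau> = 0"
    using theta1_minus[OF assms(1), of 0] by simp
  then show ?thesis
    using theta_function_zero_add_lattice[OF theta_function_theta1[OF assms(1)] _ _ assms(2), of 0]
    by simp
qed

lemma theta1_eq_theta_product:
  assumes "Im \<tau> > 0"
  shows "\<exists>c. c \<noteq> 0 \<and> (\<forall>z. theta1 z \<tau> = c * theta_product \<tau> z)"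
proof -
  have "\<exists>c. \<forall>z. theta1 z \<tau> = c * theta_product \<tau> z"
    using assms
    by (intro theta_function_constant_multiple[OF theta_function_theta1 theta_function_theta_product]
        simple_zeros_theta_product theta1_lattice_eq_0 theta_product_eq_0_imp_lattice) auto
  then obtain c where "\<forall>z. theta1 z \<tau> = c * theta_product \<tau> z"
    by blast
  moreover obtain z where "theta1 z \<tau> \<noteq> 0"
    using theta1_not_identically_zero[OF assms] .
  ultimately show ?thesis
    by (intro exI[of _ c]) auto
qed

lemma theta1_eq_0_iff:
  assumes "Im \<tau> > 0"
  shows "theta1 z \<tau> = 0 \<longleftrightarrow> z \<in> theta_lattice \<tau>"
proof
  obtain c where "c \<noteq> 0" "\<And>z. theta1 z \<tau> = c * theta_product \<tau> z"
    using theta1_eq_theta_product[OF assms] by blast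
  then show "z \<in> theta_lattice \<tau>" if "theta1 z \<tau> = 0"
    using that theta_product_eq_0_imp_lattice[OF assms] by simp
qed (rule theta1_lattice_eq_0[OF assms])

lemma simple_zeros_theta1:
  assumes "Im \<tau> > 0"
  shows "simple_zeros (\<lambda>z. theta1 z \<tau>)"
proof -
  obtain c where "c \<noteq> 0" "\<And>z. theta1 z \<tau> = c * theta_product \<tau> z"
    using theta1_eq_theta_product[OF assms] by blast
  then show ?thesis
    by (simp add: simple_zeros_cmult holomorphic_theta_product simple_zeros_theta_product assms)
qed


section \<open>Odd theta functions of degree six\<close>

definition odd_theta6 :: "complex \<Rightarrow> (complex \<Rightarrow> complex) \<Rightarrow> bool" where
  "odd_theta6 \<tau> f \<longleftrightarrow> theta_function \<tau> 6 1 (qpow \<tau> (- 3)) f \<and> (\<forall>z. f (- z) = - f z)"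

lemma odd_theta6_theta_function: "odd_theta6 \<tau> f \<Longrightarrow> theta_function \<tau> 6 1 (qpow \<tau> (- 3)) f"
  and odd_theta6_odd: "odd_theta6 \<tau> f \<Longrightarrow> f (- z) = - f z"
  by (simp_all add: odd_theta6_def)

lemma odd_theta6_diff:
  assumes "odd_theta6 \<tau> f" "odd_theta6 \<tau> g"
  shows "odd_theta6 \<tau> (\<lambda>z. f z - g z)"
  using assms by (simp add: odd_theta6_def theta_function_diff)

lemma odd_theta6_cmult:
  assumes "odd_theta6 \<tau> f"
  shows "odd_theta6 \<tau> (\<lambda>z. c * f z)"
  using assms by (simp add: odd_theta6_def theta_function_cmult)

lemma odd_theta6_zero_add_lattice:
  assumes "odd_theta6 \<tau> f" "\<omega> \<in> theta_lattice \<tau>"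
  shows "f (z + \<omega>) = 0 \<longleftrightarrow> f z = 0"
  using theta_function_zero_add_lattice[OF odd_theta6_theta_function[OF assms(1)] _ _ assms(2)]
  by simp

lemma odd_theta6_half_period_eq_0:
  assumes "odd_theta6 \<tau> f"
  shows "f 0 = 0" "f (of_real pi / 2) = 0" "f (of_real pi * \<tau> / 2) = 0"
    "f (of_real pi / 2 + of_real pi * \<tau> / 2) = 0"
proof -
  define t where "t = of_real pi * \<tau> / 2"
  have "of_real pi * \<tau> = 2 * t"
    by (simp add: t_def)
  note add_pi = theta_function_add_pi[OF odd_theta6_theta_function[OF assms]]
    and add_pi_tau = theta_function_add_pi_tau[OF odd_theta6_theta_function[OF assms], unfolded this]
  have eq_0: "f h = 0" if "f h = f (- h)" for h
    using odd_theta6_odd[OF assms, of h] that by simp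
  show "f 0 = 0"
    by (rule eq_0) simp
  show "f (of_real pi / 2) = 0"
    using add_pi[of "- of_real pi / 2"] by (intro eq_0) simp
  have multiplier: "qpow \<tau> (- 3) * exp (12 * \<i> * t) = 1"
    by (simp add: t_def qpow_def mult_ac flip: exp_add)
  have "f (- t + 2 * t) = f (- t)"
    unfolding add_pi_tau using multiplier by simp
  then have "f t = 0"
    by (intro eq_0) simp
  then show "f (of_real pi * \<tau> / 2) = 0"
    by (simp add: t_def)
  have "exp (- 2 * \<i> * of_nat 6 * (of_real pi / 2 - t)) =
      exp (2 * \<i> * (- 3 * of_real pi)) * exp (12 * \<i> * t)"
    by (simp add: algebra_simps flip: exp_add)
  also have "exp (2 * \<i> * (- 3 * of_real pi)) = 1"
    unfolding exp_2_i_eq_1_iff by (rule exI[of _ "- 3"]) simp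
  finally have "f (of_real pi / 2 - t + 2 * t) = f (of_real pi / 2 - t)"
    unfolding add_pi_tau using multiplier by simp
  also have "\<dots> = f (- (of_real pi / 2 + t))"
    using add_pi[of "- (of_real pi / 2 + t)"] by simp
  finally have "f (of_real pi / 2 + t) = 0"
    by (intro eq_0) (simp add: add.commute)
  then show "f (of_real pi / 2 + of_real pi * \<tau> / 2) = 0"
    by (simp add: t_def)
qed

lemma odd_theta6_half_lattice_eq_0:
  assumes "odd_theta6 \<tau> f" "2 * z \<in> theta_lattice \<tau>"
  shows "f z = 0"
proof -
  obtain m n where double: "2 * z = of_int m * of_real pi + of_int n * (of_real pi * \<tau>)"
    using assms(2) by (rule period_latticeE)
  define h where "h = of_int (m mod 2) * (of_real pi / 2) + of_int (n mod 2) * (of_real pi * \<tau> / 2)"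
  define \<omega> where "\<omega> = of_int (m div 2) * of_real pi + of_int (n div 2) * (of_real pi * \<tau>)"
  have "z = h + \<omega>"
  proof -
    have split: "(of_int k :: complex) = 2 * of_int (k div 2) + of_int (k mod 2)" for k
      by (subst mult_div_mod_eq[of 2 k, symmetric])
        (simp only: of_int_add of_int_mult of_int_numeral)
    have "2 * z = 2 * (h + \<omega>)"
      unfolding double split[of m] split[of n] h_def \<omega>_def by (simp add: algebra_simps)
    then show ?thesis
      by (simp only: mult_cancel_left) simp
  qed
  moreover have "\<omega> \<in> theta_lattice \<tau>"
    by (rule period_latticeI) (rule \<omega>_def)
  moreover have "m mod 2 \<in> {0, 1}" "n mod 2 \<in> {0, 1}"
    by auto
  then have "f h = 0"
    using odd_theta6_half_period_eq_0[OF assms(1)] by (auto simp: h_def)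
  ultimately show ?thesis
    by (simp add: odd_theta6_zero_add_lattice[OF assms(1)])
qed

lemma odd_theta6_odd_part:
  assumes "F holomorphic_on UNIV" and per: "\<And>z. F z = F (z + of_real pi)"
    and quasi_per: "\<And>z. F (z + of_real pi) = qpow \<tau> 3 * exp (12 * \<i> * z) * F (z + of_real pi * \<tau>)"
  shows "odd_theta6 \<tau> (\<lambda>z. F z - F (- z))"
proof -
  have "F (z + of_real pi * \<tau>) = qpow \<tau> (- 3) * exp (- 2 * \<i> * of_nat 6 * z) * F z" for z
    using per[of z] quasi_per[of z] by (simp add: qpow_minus exp_minus field_simps)
  then have F: "theta_function \<tau> 6 1 (qpow \<tau> (- 3)) F"
    by (intro theta_functionI) (simp_all add: assms(1) flip: per)
  have "inverse (qpow \<tau> (- 3)) * exp (- 2 * \<i> * of_nat 6 * (of_real pi * \<tau>)) = qpow \<tau> (- 3)"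
    by (simp add: qpow_def algebra_simps flip: exp_add exp_minus)
  then have "theta_function \<tau> 6 1 (qpow \<tau> (- 3)) (\<lambda>z. F (- z))"
    using theta_function_reflect[OF F] by simp
  with F show ?thesis
    by (simp add: odd_theta6_def theta_function_diff)
qed

definition theta1_kernel :: "complex \<Rightarrow> complex \<Rightarrow> complex \<Rightarrow> complex" where
  "theta1_kernel \<tau> x y = theta1 (x - y) \<tau> * theta1 (x + y) \<tau> * theta1 (2 * x) \<tau> * theta1 (2 * y) \<tau>"

lemma theta1_kernel_eq_0_iff:
  assumes "Im \<tau> > 0"
  shows "theta1_kernel \<tau> x y = 0 \<longleftrightarrow> x - y \<in> theta_lattice \<tau> \<or> x + y \<in> theta_lattice \<tau> \<or>
    2 * x \<in> theta_lattice \<tau> \<or> 2 * y \<in> theta_lattice \<tau>"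
  by (simp add: theta1_kernel_def theta1_eq_0_iff[OF assms] disj_assoc)

lemma theta1_kernel_swap:
  assumes "Im \<tau> > 0"
  shows "theta1_kernel \<tau> y x = - theta1_kernel \<tau> x y"
  using theta1_minus[OF assms, of "x - y"] by (simp add: theta1_kernel_def add.commute)

lemma odd_theta6_theta1_kernel:
  assumes "Im \<tau> > 0"
  shows "odd_theta6 \<tau> (\<lambda>x. theta1_kernel \<tau> x y)"
  unfolding odd_theta6_def
proof (intro conjI allI)
  note theta1 = theta_function_theta1[OF assms]
  note product = theta_function_cmult[OF theta_function_mult[OF theta_function_mult[OF
      theta_function_translate[OF theta1, of "- y"] theta_function_translate[OF theta1, of y]]
      theta_function_double[OF theta1]], of "theta1 (2 * y) \<tau>"]
  have "- qpow \<tau> (- 1/2) * exp (- 2 * \<i> * of_nat 1 * - y) *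
      (- qpow \<tau> (- 1/2) * exp (- 2 * \<i> * of_nat 1 * y)) *
      ((- qpow \<tau> (- 1/2))\<^sup>2 * exp (- 2 * \<i> * of_nat 1 * (of_real pi * \<tau>))) = qpow \<tau> (- 3)"
    by (simp add: qpow_def power2_eq_square algebra_simps flip: exp_add)
  with product show "theta_function \<tau> 6 1 (qpow \<tau> (- 3)) (\<lambda>x. theta1_kernel \<tau> x y)"
    by (simp add: theta1_kernel_def mult_ac)
  show "theta1_kernel \<tau> (- x) y = - theta1_kernel \<tau> x y" for x
    using theta1_minus[OF assms, of "x - y"] theta1_minus[OF assms, of "x + y"]
      theta1_minus[OF assms, of "2 * x"]
    by (simp add: theta1_kernel_def)
qed

lemma simple_zeros_theta1_kernel:
  assumes "Im \<tau> > 0" and y: "2 * y \<notin> theta_lattice \<tau>"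
  shows "simple_zeros (\<lambda>x. theta1_kernel \<tau> x y)"
proof -
  note zero_iff = theta1_eq_0_iff[OF assms(1)]
  note affine = simple_zeros_affine[OF holomorphic_theta1[OF assms(1)] simple_zeros_theta1[OF assms(1)]]
  have holomorphic: "(\<lambda>x. theta1 (g x) \<tau>) holomorphic_on UNIV" if "g holomorphic_on UNIV" for g
    by (rule entire_compose[OF holomorphic_theta1[OF assms(1)] that])
  have no_common_zero: "x + y \<notin> theta_lattice \<tau>" if "x - y \<in> theta_lattice \<tau>" for x
    using y period_lattice_diff[of "x + y" _ _ "x - y"] that by (auto simp: algebra_simps)
  have "simple_zeros (\<lambda>x. theta1 (x - y) \<tau>)" "simple_zeros (\<lambda>x. theta1 (x + y) \<tau>)"
    using affine[of 1 "- y"] affine[of 1 y] by simp_all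
  then have translates: "simple_zeros (\<lambda>x. theta1 (x - y) \<tau> * theta1 (x + y) \<tau>)"
    using no_common_zero
    by (intro simple_zeros_mult holomorphic holomorphic_intros) (simp_all add: zero_iff)
  have no_common_zero_double: "2 * x \<notin> theta_lattice \<tau>"
    if "x - y \<in> theta_lattice \<tau> \<or> x + y \<in> theta_lattice \<tau>" for x
    using no_common_zero[of x] period_lattice_diff[of "2 * x" _ _ "x - y"]
      period_lattice_diff[of "2 * x" _ _ "x + y"] that by (auto simp: algebra_simps)
  have double: "simple_zeros (\<lambda>x. theta1 (2 * x) \<tau>)"
    using affine[of 2 0] by simp
  have "simple_zeros (\<lambda>x. theta1 (x - y) \<tau> * theta1 (x + y) \<tau> * theta1 (2 * x) \<tau>)"
    using no_common_zero_double
    by (intro simple_zeros_mult[OF _ _ translates double] holomorphic_on_mult holomorphic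
        holomorphic_intros) (auto simp: zero_iff)
  then have "simple_zeros (\<lambda>x. theta1 (2 * y) \<tau> *
      (theta1 (x - y) \<tau> * theta1 (x + y) \<tau> * theta1 (2 * x) \<tau>))"
    using y by (intro simple_zeros_cmult holomorphic_on_mult holomorphic holomorphic_intros)
      (simp_all add: zero_iff)
  then show ?thesis
    by (simp add: theta1_kernel_def mult_ac)
qed

lemma odd_theta6_kernel_multiple:
  assumes "Im \<tau> > 0" and f: "odd_theta6 \<tau> f" "f y = 0" and y: "2 * y \<notin> theta_lattice \<tau>"
  shows "\<exists>c. \<forall>x. f x = c * theta1_kernel \<tau> x y"
proof -
  have "f x = 0" if "theta1_kernel \<tau> x y = 0" for x
  proof -
    consider (difference) "x - y \<in> theta_lattice \<tau>" | (sum) "x + y \<in> theta_lattice \<tau>"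
      | (half_period) "2 * x \<in> theta_lattice \<tau>"
      using \<open>theta1_kernel \<tau> x y = 0\<close> y by (auto simp: theta1_kernel_eq_0_iff[OF assms(1)])
    then show ?thesis
    proof cases
      case difference
      then show ?thesis
        using odd_theta6_zero_add_lattice[OF f(1), of "x - y" y] f(2) by simp
    next
      case sum
      then show ?thesis
        using odd_theta6_zero_add_lattice[OF f(1), of "x + y" "- y"] odd_theta6_odd[OF f(1), of y] f(2)
        by simp
    next
      case half_period
      then show ?thesis
        by (rule odd_theta6_half_lattice_eq_0[OF f(1)])
    qed
  qed
  then show ?thesis
    using assms(1) y
    by (intro theta_function_constant_multiple[OF odd_theta6_theta_function[OF f(1)]
          odd_theta6_theta_function[OF odd_theta6_theta1_kernel]] simple_zeros_theta1_kernel) auto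
qed

lemma odd_theta6_eq_0:
  assumes "Im \<tau> > 0" and uv: "theta1_kernel \<tau> u v \<noteq> 0"
    and f: "odd_theta6 \<tau> f" "f u = 0" "f v = 0"
  shows "f z = 0"
proof -
  have "2 * v \<notin> theta_lattice \<tau>"
    using uv by (simp add: theta1_kernel_eq_0_iff[OF assms(1)])
  then obtain c where c: "\<And>x. f x = c * theta1_kernel \<tau> x v"
    using odd_theta6_kernel_multiple[OF assms(1) f(1,3)] by blast
  with \<open>f u = 0\<close> uv have "c = 0"
    by simp
  with c show ?thesis
    by simp
qed

lemma alternating_odd_theta6_eq_0:
  assumes "Im \<tau> > 0" and uv: "theta1_kernel \<tau> u v \<noteq> 0"
    and K: "\<And>y. odd_theta6 \<tau> (\<lambda>x. K x y)" and swap: "\<And>x y. K y x = - K x y" and "K u v = 0"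
  shows "K x y = 0"
proof -
  note vanish = odd_theta6_eq_0[OF assms(1) uv K]
  have diagonal: "K x x = 0" for x
    using swap[of x x] by simp
  have "K v u = 0"
    using swap[of u v] \<open>K u v = 0\<close> by simp
  have "K x u = 0" "K x v = 0" for x
    using vanish diagonal \<open>K u v = 0\<close> \<open>K v u = 0\<close> by blast+
  then have "K u y = 0" "K v y = 0"
    using swap[of u y] swap[of v y] by simp_all
  then show ?thesis
    by (rule vanish)
qed

lemma real_multiple_pi_in_theta_lattice_iff:
  assumes "Im \<tau> \<noteq> 0"
  shows "of_real (r * pi) \<in> theta_lattice \<tau> \<longleftrightarrow> r \<in> \<int>"
proof
  assume "of_real (r * pi) \<in> theta_lattice \<tau>"
  then obtain m n where "of_real (r * pi) = of_int m * of_real pi + of_int n * (of_real pi * \<tau>)"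
    by (rule period_latticeE)
  then have "0 = of_int n * (pi * Im \<tau>)" "r * pi = of_int m * pi + of_int n * (pi * Re \<tau>)"
    by (simp_all add: complex_eq_iff)
  with assms show "r \<in> \<int>"
    by auto
next
  assume "r \<in> \<int>"
  then obtain m where "r = of_int m"
    by (auto elim: Ints_cases)
  then show "of_real (r * pi) \<in> theta_lattice \<tau>"
    by (intro period_latticeI[of _ m _ 0]) simp
qed

lemma theta1_kernel_not_identically_zero:
  assumes "Im \<tau> > 0"
  obtains u v where "theta1_kernel \<tau> u v \<noteq> 0"
proof
  have "r \<notin> \<int>" if "0 < r" "r < 1" for r :: real
    using that by (auto elim!: Ints_cases)
  then have "of_real (r * pi) \<notin> theta_lattice \<tau>" if "0 < r" "r < 1" for r :: real
    using that assms by (subst real_multiple_pi_in_theta_lattice_iff) auto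
  from this[of "1/5"] this[of "2/5"] this[of "3/5"] this[of "4/5"]
  show "theta1_kernel \<tau> (of_real (2/5 * pi)) (of_real (1/5 * pi)) \<noteq> 0"
    by (simp add: theta1_kernel_eq_0_iff[OF assms])
qed

theorem theorem1p17:
  fixes \<tau> :: complex and F G :: "complex \<Rightarrow> complex"
  assumes "Im \<tau> > 0"
    and "F holomorphic_on UNIV" and "G holomorphic_on UNIV"
    and "\<And>z. F z = F (z + of_real pi)"
    and "\<And>z. F (z + of_real pi) = qpow \<tau> 3 * exp (12 * \<i> * z) * F (z + of_real pi * \<tau>)"
    and "\<And>z. G z = G (z + of_real pi)"
    and "\<And>z. G (z + of_real pi) = qpow \<tau> 3 * exp (12 * \<i> * z) * G (z + of_real pi * \<tau>)"
  shows "\<exists>C::complex. \<forall>x y.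
    (F x - F (- x)) * (G y - G (- y)) - (F y - F (- y)) * (G x - G (- x))
      = C * theta1 (x - y) \<tau> * theta1 (x + y) \<tau> * theta1 (2 * x) \<tau> * theta1 (2 * y) \<tau>"
proof -
  define f g where "f = (\<lambda>z. F z - F (- z))" and "g = (\<lambda>z. G z - G (- z))"
  have f: "odd_theta6 \<tau> f" and g: "odd_theta6 \<tau> g"
    unfolding f_def g_def using assms by (blast intro: odd_theta6_odd_part)+
  obtain u v where uv: "theta1_kernel \<tau> u v \<noteq> 0"
    using theta1_kernel_not_identically_zero[OF assms(1)] .
  define C where "C = (g v * f u - f v * g u) / theta1_kernel \<tau> u v"
  define K where "K = (\<lambda>x y. g y * f x - f y * g x - C * theta1_kernel \<tau> x y)"
  have "odd_theta6 \<tau> (\<lambda>x. K x y)" for y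
    unfolding K_def by (intro odd_theta6_diff odd_theta6_cmult f g odd_theta6_theta1_kernel assms(1))
  moreover have "K y x = - K x y" for x y
    by (simp add: K_def theta1_kernel_swap[OF assms(1), of x y])
  moreover have "K u v = 0"
    using uv by (simp add: K_def C_def)
  ultimately have "K x y = 0" for x y
    by (rule alternating_odd_theta6_eq_0[OF assms(1) uv])
  then show ?thesis
    by (intro exI[of _ C]) (simp add: K_def f_def g_def theta1_kernel_def mult_ac)
qed

end
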